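(* For every integer $n\ge 2$, the maximal total degree in the Hasse diagram of the strong Bruhat order on $S_n$ is $\lfloor n^2/4\rfloor+n-2$; that is, $$\max\{d(\pi)\mid \pi\in S_n\}=\lfloor n^2/4 \rfloor +n-2.$$
   Context: $S_n$ is the symmetric group on $\{1,\dots,n\}$; a permutation $\pi$ is written as its sequence of values $[\pi(1),\dots,\pi(n)]$. For $1\le a<b\le n$, $t_{a,b}\in S_n$ is the transposition interchanging $a$ and $b$; $t_{a,b}\pi$ is obtained from $\pi$ by interchanging the values $a$ and $b$. The length $\ell(\pi)$ is the minimal $k$ such that $\pi$ is a product of $k$ adjacent transpositions $s_i=t_{i,i+1}$ ($1\le i<n$). The total degree $d(\pi)$ is the valency of $\pi$ in the Hasse diagram of the strong Bruhat order on $S_n$ (the number of permutations covered by $\pi$ plus the number of permutations covering $\pi$); equivalently $d(\pi)=\#\{t_{a,b}\mid 1\le a<b\le n,\ \ell(t_{a,b}\pi)=\ell(\pi)\pm1\}$. *)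

theory Defs
  imports "HOL-Combinatorics.Permutations"
begin

text \<open>
  A permutation in \<open>S\<^sub>n\<close> is a function \<open>\<pi> :: nat \<Rightarrow> nat\<close> with \<open>\<pi> permutes {1..n}\<close>; it is the identity
  outside \<open>{1..n}\<close>. Products are compositions, so \<open>Transposition.transpose a b \<circ> \<pi>\<close> interchanges the
  \<^emph>\<open>values\<close> \<open>a\<close> and \<open>b\<close> of \<open>\<pi>\<close>.
\<close>

text \<open>
  \<open>apply_adj_transps [i\<^sub>1, \<dots>, i\<^sub>k]\<close> is the product of the \<open>transpose i\<^sub>j (i\<^sub>j + 1)\<close>. The value is
  only meaningful if \<open>\<pi> permutes {1..n}\<close>: otherwise no such word exists.
\<close>

definition perm_length :: "nat \<Rightarrow> (nat \<Rightarrow> nat) \<Rightarrow> nat" where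
  "perm_length n \<pi> =
     (LEAST k. \<exists>is. set is \<subseteq> {1..<n} \<and> length is = k \<and> apply_adj_transps is = \<pi>)"

text \<open>
  The strong Bruhat order is the reflexive-transitive closure of the relation that takes \<open>\<pi>\<close> to
  \<open>t\<^bsub>a,b\<^esub> \<pi>\<close> whenever this increases the length (by any amount). Multiplying by transpositions on
  the right gives the same relation, as conjugates of transpositions are transpositions.
\<close>

definition bruhat_step :: "nat \<Rightarrow> (nat \<Rightarrow> nat) \<Rightarrow> (nat \<Rightarrow> nat) \<Rightarrow> bool" where
  "bruhat_step n \<pi> \<sigma> \<longleftrightarrow>
     (\<exists>a b. 1 \<le> a \<and> a < b \<and> b \<le> n \<and> \<sigma> = Transposition.transpose a b \<circ> \<pi>) \<and>
     perm_length n \<pi> < perm_length n \<sigma>"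

definition bruhat_le :: "nat \<Rightarrow> (nat \<Rightarrow> nat) \<Rightarrow> (nat \<Rightarrow> nat) \<Rightarrow> bool" where
  "bruhat_le n \<pi> \<sigma> \<longleftrightarrow> \<pi> permutes {1..n} \<and> \<sigma> permutes {1..n} \<and> (bruhat_step n)\<^sup>*\<^sup>* \<pi> \<sigma>"

definition bruhat_less :: "nat \<Rightarrow> (nat \<Rightarrow> nat) \<Rightarrow> (nat \<Rightarrow> nat) \<Rightarrow> bool" where
  "bruhat_less n \<pi> \<sigma> \<longleftrightarrow> bruhat_le n \<pi> \<sigma> \<and> \<pi> \<noteq> \<sigma>"

definition bruhat_covered_by :: "nat \<Rightarrow> (nat \<Rightarrow> nat) \<Rightarrow> (nat \<Rightarrow> nat) \<Rightarrow> bool" where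
  "bruhat_covered_by n \<pi> \<sigma> \<longleftrightarrow>
     bruhat_less n \<pi> \<sigma> \<and> \<not> (\<exists>\<rho>. bruhat_less n \<pi> \<rho> \<and> bruhat_less n \<rho> \<sigma>)"

definition total_degree :: "nat \<Rightarrow> (nat \<Rightarrow> nat) \<Rightarrow> nat" where
  "total_degree n \<pi> =
     card {\<sigma>. bruhat_covered_by n \<sigma> \<pi>} + card {\<sigma>. bruhat_covered_by n \<pi> \<sigma>}"

end

theory Submission
  imports Defs
begin

text \<open>
  A permutation \<open>\<pi>\<close> is viewed as the point set \<open>{(i, \<pi> i)}\<close> in the plane. The length of \<open>\<pi>\<close> is its
  number of inversions. Exchanging two points that are in order raises this number by one plus
  twice the number of points inside the rectangle that they span, and the exchange factors into
  three that each increase the length if there is such a point. So the neighbours of \<open>\<pi>\<close> in the Hasse diagram of the Bruhat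
  order correspond to the pairs of points that span a rectangle with no third point inside
  (\<open>total_degree_eq_card_visible_pairs\<close>). Call such pairs of points visible. The claim is
  now a statement on plane point sets: \<open>n\<close> points in general position have at most
  \<open>n\<^sup>2 div 4 + n - 2\<close> visible pairs, and some permutation attains this number.

  For the upper bound (\<open>card_visible_pairs_le\<close>), take a visible pair \<open>p\<close>, \<open>q\<close> of maximal horizontal
  extent. A third point that sees both \<open>p\<close> and \<open>q\<close> must lie horizontally between them, because
  otherwise it would form a wider visible pair with one of them. It then lies above both or below
  both; of two such points on the same side, the one that is vertically nearer to \<open>p\<close> and \<open>q\<close>
  hides the other from \<open>p\<close> or from \<open>q\<close>. So \<open>p\<close> and \<open>q\<close> have at most two common neighbours, hence at most
  \<open>1 + (n - 2) + 2 = n + 1\<close> visible pairs involve \<open>p\<close> or \<open>q\<close>. Deleting points may create visible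
  pairs but never destroys one among the remaining points, so induction from \<open>n - 2\<close> to \<open>n\<close> applies, and
  \<open>n + 1\<close> is exactly the growth of the bound.

  For the lower bound (\<open>le_card_visible_pairs_two_blocks\<close>), take two increasing blocks of as equal
  length as possible, the left one above the right one: \<open>[h+1, \<dots>, n, 1, \<dots>, h]\<close> with
  \<open>h = n div 2\<close>. Each point of the left block sees each point of the right one, and consecutive
  points of the same block see each other.
\<close>


section \<open>Inversions and length\<close>

definition inversions :: "nat \<Rightarrow> (nat \<Rightarrow> nat) \<Rightarrow> (nat \<times> nat) set" where
  "inversions n \<pi> = {(k, l). 1 \<le> k \<and> k < l \<and> l \<le> n \<and> \<pi> l < \<pi> k}"

lemma finite_inversions [simp]: "finite (inversions n \<pi>)"
  by (rule finite_subset[of _ "{1..n} \<times> {1..n}"]) (auto simp: inversions_def)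

lemma inversions_id: "inversions n id = {}"
  by (auto simp: inversions_def)

text \<open>
  If the positions of a pair are moved by a transposition, the moved pair is again increasing,
  except for the pair \<open>(i, j)\<close> itself and the pairs of \<open>i\<close> or \<open>j\<close> with a position between them.
  Leaving the exceptional pairs alone gives an involution on increasing pairs, which is used to
  compare the inversions of \<open>\<pi>\<close> and \<open>\<pi> \<circ> Transposition.transpose i j\<close>.
\<close>

definition move_pair :: "nat \<Rightarrow> nat \<Rightarrow> nat \<times> nat \<Rightarrow> nat \<times> nat" where
  "move_pair i j = (\<lambda>(k, l).
     let k' = Transposition.transpose i j k; l' = Transposition.transpose i j l
     in if k' < l' then (k', l') else (k, l))"

lemma move_pair_involution: "fst x < snd x \<Longrightarrow> move_pair i j (move_pair i j x) = x"
  by (cases x) (auto simp: move_pair_def Let_def)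

lemma inj_on_move_pair_inversions: "inj_on (move_pair i j) (inversions n \<pi>)"
proof (rule inj_on_inverseI)
  fix x assume "x \<in> inversions n \<pi>"
  then show "move_pair i j (move_pair i j x) = x"
    by (intro move_pair_involution) (auto simp: inversions_def)
qed

text \<open>
  An inversion whose order survives the move carries its two values along. For an exceptional
  inversion, say \<open>(i, m)\<close> with \<open>i < m < j\<close>, the value at \<open>i\<close> only grows from \<open>\<pi> i\<close> to \<open>\<pi> j\<close>, so the
  pair remains an inversion; similarly for \<open>(m, j)\<close>.
\<close>

lemma move_pair_inversions_subset:
  assumes "1 \<le> i" "i < j" "j \<le> n" "\<pi> i < \<pi> j"
  shows "move_pair i j ` inversions n \<pi>
           \<subseteq> inversions n (\<pi> \<circ> Transposition.transpose i j) - {(i, j)}"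
proof
  fix y assume "y \<in> move_pair i j ` inversions n \<pi>"
  then obtain k l where kl: "(k, l) \<in> inversions n \<pi>" and y: "y = move_pair i j (k, l)"
    by auto
  have "y \<in> inversions n (\<pi> \<circ> Transposition.transpose i j)"
    using kl y assms
    by (auto simp: move_pair_def inversions_def Let_def Transposition.transpose_def split: if_splits)
  moreover have "y \<noteq> (i, j)"
  proof
    assume "y = (i, j)"
    moreover have "move_pair i j (i, j) = (i, j)"
      using assms by (simp add: move_pair_def)
    ultimately have "(k, l) = (i, j)"
      using kl y move_pair_involution[of "(k, l)" i j] by (simp add: inversions_def)
    then show False
      using kl assms by (simp add: inversions_def)
  qed
  ultimately show "y \<in> inversions n (\<pi> \<circ> Transposition.transpose i j) - {(i, j)}"
    by simp
qed

lemma card_inversions_less: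
  assumes "1 \<le> i" "i < j" "j \<le> n" "\<pi> i < \<pi> j"
  shows "card (inversions n \<pi>) < card (inversions n (\<pi> \<circ> Transposition.transpose i j))"
proof -
  have mem: "(i, j) \<in> inversions n (\<pi> \<circ> Transposition.transpose i j)"
    using assms by (simp add: inversions_def)
  have "card (inversions n \<pi>) \<le> card (inversions n (\<pi> \<circ> Transposition.transpose i j) - {(i, j)})"
    using card_inj_on_le[OF inj_on_move_pair_inversions move_pair_inversions_subset[where n = n]]
      assms by simp
  also have "\<dots> < card (inversions n (\<pi> \<circ> Transposition.transpose i j))"
    using mem by (intro card_Diff1_less) auto
  finally show ?thesis .
qed

text \<open>
  The only inversions of the new permutation that are not accounted for by \<open>move_pair\<close> are \<open>(i, j)\<close>
  itself and those pairs \<open>(i, m)\<close> and \<open>(m, j)\<close> for which \<open>(m, \<pi> m)\<close> lies in the rectangle spanned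
  by the two exchanged points.
\<close>

lemma card_inversions_Suc:
  assumes ij: "1 \<le> i" "i < j" "j \<le> n" "\<pi> i < \<pi> j" and inj: "inj_on \<pi> {1..n}"
    and empty: "\<And>m. i < m \<Longrightarrow> m < j \<Longrightarrow> \<not> (\<pi> i < \<pi> m \<and> \<pi> m < \<pi> j)"
  shows "card (inversions n (\<pi> \<circ> Transposition.transpose i j)) = Suc (card (inversions n \<pi>))"
proof -
  let ?\<sigma> = "\<pi> \<circ> Transposition.transpose i j"
  have neq: "\<pi> m \<noteq> \<pi> i" "\<pi> m \<noteq> \<pi> j" if "i < m" "m < j" for m
    using inj_onD[OF inj, of m i] inj_onD[OF inj, of m j] that ij by auto
  have "inversions n ?\<sigma> - {(i, j)} \<subseteq> move_pair i j ` inversions n \<pi>"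
  proof
    fix x assume x: "x \<in> inversions n ?\<sigma> - {(i, j)}"
    obtain k l where kl: "x = (k, l)" by (cases x)
    have "move_pair i j (k, l) \<in> inversions n \<pi>"
    proof (cases "Transposition.transpose i j k < Transposition.transpose i j l")
      case True
      then show ?thesis
        using x kl ij
        by (auto simp: move_pair_def inversions_def Transposition.transpose_def split: if_splits)
    next
      case False
      have "k < l" "(k, l) \<noteq> (i, j)" "?\<sigma> l < ?\<sigma> k"
        using x kl by (auto simp: inversions_def)
      with False ij consider "k = i" "i < l" "l < j" "\<pi> l < \<pi> j" | "l = j" "i < k" "k < j" "\<pi> i < \<pi> k"
        by (auto simp: Transposition.transpose_def split: if_splits)
      then have "\<pi> l < \<pi> k"
        using empty[of l] empty[of k] neq[of l] neq[of k]
        by cases (auto simp: not_less le_less)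
      then show ?thesis
        using False x kl by (auto simp: move_pair_def inversions_def)
    qed
    moreover have "move_pair i j (move_pair i j (k, l)) = (k, l)"
      using x kl by (intro move_pair_involution) (auto simp: inversions_def)
    ultimately show "x \<in> move_pair i j ` inversions n \<pi>"
      unfolding kl by (metis imageI)
  qed
  then have "inversions n ?\<sigma> - {(i, j)} = move_pair i j ` inversions n \<pi>"
    using move_pair_inversions_subset[OF ij] by blast
  then have "card (inversions n ?\<sigma> - {(i, j)}) = card (inversions n \<pi>)"
    by (simp add: card_image inj_on_move_pair_inversions)
  moreover have "(i, j) \<in> inversions n ?\<sigma>"
    using ij by (simp add: inversions_def)
  ultimately show ?thesis
    by (metis card_Suc_Diff1 finite_inversions)
qed

lemma card_inversions_adjacent:
  assumes "1 \<le> i" "i < n" "\<pi> i < \<pi> (i + 1)" "inj_on \<pi> {1..n}"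
  shows "card (inversions n (\<pi> \<circ> Transposition.transpose i (i + 1))) = Suc (card (inversions n \<pi>))"
  using assms by (intro card_inversions_Suc) auto

lemma permutes_comp_transpose:
  fixes n :: nat
  assumes "\<pi> permutes {1..n}" "1 \<le> i" "i \<le> n" "1 \<le> j" "j \<le> n"
  shows "(\<pi> \<circ> Transposition.transpose i j) permutes {1..n}"
  using assms by (intro permutes_compose permutes_swap_id) auto

lemma card_inversions_adjacent_le:
  assumes \<pi>: "\<pi> permutes {1..n}" and i: "1 \<le> i" "i < n"
  shows "card (inversions n (\<pi> \<circ> Transposition.transpose i (i + 1))) \<le> Suc (card (inversions n \<pi>))"
proof (cases "\<pi> i < \<pi> (i + 1)")
  case True
  then show ?thesis
    using card_inversions_adjacent[OF i True permutes_inj_on[OF \<pi>]] by simp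
next
  case False
  then have less: "\<pi> (i + 1) < \<pi> i"
    using inj_onD[OF permutes_inj[OF \<pi>], of i "i + 1"] by (auto simp: not_less le_less)
  have "card (inversions n (\<pi> \<circ> Transposition.transpose i (i + 1)))
          < card (inversions n (\<pi> \<circ> Transposition.transpose i (i + 1) \<circ> Transposition.transpose i (i + 1)))"
    using i less by (intro card_inversions_less) auto
  then show ?thesis
    by (simp add: comp_assoc)
qed

lemma permutes_no_descent_imp_id:
  fixes n :: nat
  assumes \<pi>: "\<pi> permutes {1..n}" and mono: "\<And>i. 1 \<le> i \<Longrightarrow> i < n \<Longrightarrow> \<pi> i < \<pi> (i + 1)"
  shows "\<pi> = id"
proof (rule permutes_natset_ge[OF \<pi>])
  have "i \<le> \<pi> i" if "1 \<le> i" "i \<le> n" for i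
    using that
  proof (induction i rule: dec_induct)
    case base
    then show ?case using permutes_in_seg[OF \<pi>, of 1] by simp
  next
    case (step i)
    then show ?case using mono[of i] by simp
  qed
  then show "\<forall>i\<in>{1..n}. i \<le> \<pi> i" by simp
qed

text \<open>Sorting by adjacent exchanges: each one that resolves a descent removes one inversion.\<close>

lemma reduced_word_exists:
  assumes "\<pi> permutes {1..n}"
  shows "\<exists>is. set is \<subseteq> {1..<n} \<and> length is = card (inversions n \<pi>) \<and> apply_adj_transps is = \<pi>"
  using assms
proof (induction "card (inversions n \<pi>)" arbitrary: \<pi> rule: less_induct)
  case less
  show ?case
  proof (cases "\<forall>i. 1 \<le> i \<longrightarrow> i < n \<longrightarrow> \<pi> i < \<pi> (i + 1)")
    case True
    then have "\<pi> = id"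
      using permutes_no_descent_imp_id[OF less.prems] by blast
    then show ?thesis
      by (intro exI[of _ "[]"]) (simp add: inversions_id)
  next
    case False
    then obtain i where i: "1 \<le> i" "i < n" "\<not> \<pi> i < \<pi> (i + 1)"
      by blast
    then have desc: "\<pi> (i + 1) < \<pi> i"
      using inj_onD[OF permutes_inj[OF less.prems], of i "i + 1"] by (auto simp: not_less le_less)
    define \<sigma> where "\<sigma> = \<pi> \<circ> Transposition.transpose i (i + 1)"
    have \<sigma>: "\<sigma> permutes {1..n}"
      unfolding \<sigma>_def using less.prems i by (intro permutes_comp_transpose) auto
    have \<pi>: "\<pi> = \<sigma> \<circ> Transposition.transpose i (i + 1)"
      by (simp add: \<sigma>_def comp_assoc)
    have card: "card (inversions n \<pi>) = Suc (card (inversions n \<sigma>))"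
      unfolding \<pi> using i desc permutes_inj_on[OF \<sigma>]
      by (intro card_inversions_adjacent) (auto simp: \<sigma>_def)
    then obtain "is" where "set is \<subseteq> {1..<n}" "length is = card (inversions n \<sigma>)"
        "apply_adj_transps is = \<sigma>"
      using less.hyps[OF _ \<sigma>] by auto
    then show ?thesis
      using i card \<pi> by (intro exI[of _ "is @ [i]"]) auto
  qed
qed

lemma card_inversions_le_length_word:
  assumes "set is \<subseteq> {1..<n}"
  shows "card (inversions n (apply_adj_transps is)) \<le> length is"
  using assms
proof (induction "is" rule: rev_induct)
  case Nil
  show ?case unfolding apply_adj_transps_Nil inversions_id by simp
next
  case (snoc i "is")
  have "apply_adj_transps is permutes {1..n}"
    using snoc.prems by (intro permutes_apply_adj_transps) auto
  from card_inversions_adjacent_le[OF this, of i] show ?case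
    using snoc by (simp add: comp_def)
qed

lemma perm_length_eq_card_inversions:
  assumes "\<pi> permutes {1..n}"
  shows "perm_length n \<pi> = card (inversions n \<pi>)"
  unfolding perm_length_def
proof (rule Least_equality)
  show "\<exists>is. set is \<subseteq> {1..<n} \<and> length is = card (inversions n \<pi>) \<and> apply_adj_transps is = \<pi>"
    by (rule reduced_word_exists[OF assms])
next
  fix k assume "\<exists>is. set is \<subseteq> {1..<n} \<and> length is = k \<and> apply_adj_transps is = \<pi>"
  then show "card (inversions n \<pi>) \<le> k"
    using card_inversions_le_length_word by blast
qed


section \<open>Covers of the Bruhat order\<close>

text \<open>
  Exchanging the values \<open>a\<close> and \<open>b\<close> is the same as exchanging the contents of the positions where
  they occur, and the length grows exactly when the smaller of the two values stands to the left.
\<close>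

lemma bruhat_step_iff:
  assumes \<pi>: "\<pi> permutes {1..n}"
  shows "bruhat_step n \<pi> \<sigma> \<longleftrightarrow>
    (\<exists>i j. 1 \<le> i \<and> i < j \<and> j \<le> n \<and> \<pi> i < \<pi> j \<and> \<sigma> = \<pi> \<circ> Transposition.transpose i j)"
proof -
  have swap: "Transposition.transpose (\<pi> i) (\<pi> j) \<circ> \<pi> = \<pi> \<circ> Transposition.transpose i j" for i j
    using permutes_bij[OF \<pi>] by (auto simp: transpose_apply_commute fun_eq_iff bij_is_surj inv_f_f bij_is_inj)
  have len: "perm_length n (\<pi> \<circ> Transposition.transpose i j) = card (inversions n (\<pi> \<circ> Transposition.transpose i j))"
    if "1 \<le> i" "i < j" "j \<le> n" for i j
    using that \<pi> by (intro perm_length_eq_card_inversions permutes_comp_transpose) auto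
  have grow: "perm_length n \<pi> < perm_length n (\<pi> \<circ> Transposition.transpose i j) \<longleftrightarrow> \<pi> i < \<pi> j"
    if ij: "1 \<le> i" "i < j" "j \<le> n" for i j
  proof (cases "\<pi> i < \<pi> j")
    case True
    then show ?thesis
      using card_inversions_less[OF ij True] by (simp add: len[OF ij] perm_length_eq_card_inversions[OF \<pi>])
  next
    case False
    then have "\<pi> j < \<pi> i"
      using inj_onD[OF permutes_inj[OF \<pi>], of i j] ij by (auto simp: not_less le_less)
    then have "card (inversions n (\<pi> \<circ> Transposition.transpose i j))
        < card (inversions n (\<pi> \<circ> Transposition.transpose i j \<circ> Transposition.transpose i j))"
      using ij by (intro card_inversions_less) auto
    then show ?thesis
      using False by (simp add: comp_assoc len[OF ij] perm_length_eq_card_inversions[OF \<pi>])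
  qed
  show ?thesis
  proof
    assume step: "bruhat_step n \<pi> \<sigma>"
    then obtain a b where ab: "1 \<le> a" "a < b" "b \<le> n" and \<sigma>: "\<sigma> = Transposition.transpose a b \<circ> \<pi>"
      unfolding bruhat_step_def by blast
    have "a \<in> \<pi> ` {1..n}" "b \<in> \<pi> ` {1..n}"
      using ab unfolding permutes_image[OF \<pi>] by auto
    then obtain i j where ij: "1 \<le> i" "i \<le> n" "\<pi> i = a" "1 \<le> j" "j \<le> n" "\<pi> j = b"
      by auto
    have \<sigma>': "\<sigma> = \<pi> \<circ> Transposition.transpose i j"
      using \<sigma> ij swap by blast
    have "perm_length n \<pi> < perm_length n \<sigma>"
      using step by (simp add: bruhat_step_def)
    then have "i < j"
      using grow[of j i] \<sigma>' ij ab by (metis less_asym linorder_neqE_nat transpose_commute)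
    then show "\<exists>i j. 1 \<le> i \<and> i < j \<and> j \<le> n \<and> \<pi> i < \<pi> j \<and> \<sigma> = \<pi> \<circ> Transposition.transpose i j"
      using ij ab \<sigma>' by blast
  next
    assume "\<exists>i j. 1 \<le> i \<and> i < j \<and> j \<le> n \<and> \<pi> i < \<pi> j \<and> \<sigma> = \<pi> \<circ> Transposition.transpose i j"
    then obtain i j where ij: "1 \<le> i" "i < j" "j \<le> n" "\<pi> i < \<pi> j"
      and \<sigma>: "\<sigma> = \<pi> \<circ> Transposition.transpose i j"
      by blast
    have "1 \<le> \<pi> i" "\<pi> j \<le> n"
      using permutes_in_seg[OF \<pi>, of i] permutes_in_seg[OF \<pi>, of j] ij by auto
    then show "bruhat_step n \<pi> \<sigma>"
      unfolding bruhat_step_def \<sigma> using ij grow[of i j] swap[of i j] by metis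
  qed
qed

lemma bruhat_step_permutes:
  assumes "\<pi> permutes {1..n}" "bruhat_step n \<pi> \<sigma>"
  shows "\<sigma> permutes {1..n}"
  using assms permutes_comp_transpose by (auto simp: bruhat_step_iff)

lemma bruhat_less_imp_perm_length_less:
  assumes "bruhat_less n \<pi> \<sigma>"
  shows "perm_length n \<pi> < perm_length n \<sigma>"
proof -
  have "(bruhat_step n)\<^sup>+\<^sup>+ \<pi> \<sigma>"
    using assms by (auto simp: bruhat_less_def bruhat_le_def dest: rtranclpD)
  then show ?thesis
    by (induction rule: tranclp_induct) (auto simp: bruhat_step_def)
qed

lemma bruhat_step_imp_bruhat_less:
  assumes "\<pi> permutes {1..n}" "bruhat_step n \<pi> \<sigma>"
  shows "bruhat_less n \<pi> \<sigma>"
proof -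
  have "\<pi> \<noteq> \<sigma>"
    using assms by (auto simp: bruhat_step_def)
  then show ?thesis
    using assms bruhat_step_permutes[OF assms] by (simp add: bruhat_less_def bruhat_le_def)
qed

text \<open>
  The two conjuncts excluded for \<open>k\<close> belong to the two possible orientations of the rectangle. The
  point set is restricted to the positions in \<open>S\<close>, so that points can be deleted.
\<close>

definition visible_pairs :: "'a::linorder set \<Rightarrow> ('a \<Rightarrow> 'b::linorder) \<Rightarrow> ('a \<times> 'a) set" where
  "visible_pairs S \<pi> = {(i, j). i \<in> S \<and> j \<in> S \<and> i < j \<and>
     (\<forall>k\<in>S. i < k \<and> k < j \<longrightarrow> \<not> (\<pi> i < \<pi> k \<and> \<pi> k < \<pi> j) \<and> \<not> (\<pi> j < \<pi> k \<and> \<pi> k < \<pi> i))}"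

lemma visible_imp_bruhat_covered_by:
  assumes \<pi>: "\<pi> permutes {1..n}" and vis: "(i, j) \<in> visible_pairs {1..n} \<pi>" and less: "\<pi> i < \<pi> j"
  shows "bruhat_covered_by n \<pi> (\<pi> \<circ> Transposition.transpose i j)"
proof -
  let ?\<sigma> = "\<pi> \<circ> Transposition.transpose i j"
  have ij: "1 \<le> i" "i < j" "j \<le> n"
    using vis by (auto simp: visible_pairs_def)
  have step: "bruhat_step n \<pi> ?\<sigma>"
    using ij less bruhat_step_iff[OF \<pi>] by blast
  have "card (inversions n ?\<sigma>) = Suc (card (inversions n \<pi>))"
    using vis ij less permutes_inj_on[OF \<pi>]
    by (intro card_inversions_Suc) (auto simp: visible_pairs_def)
  then have "perm_length n ?\<sigma> = Suc (perm_length n \<pi>)"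
    using perm_length_eq_card_inversions[OF \<pi>]
      perm_length_eq_card_inversions[OF bruhat_step_permutes[OF \<pi> step]] by simp
  then have "\<not> (bruhat_less n \<pi> \<rho> \<and> bruhat_less n \<rho> ?\<sigma>)" for \<rho>
    using bruhat_less_imp_perm_length_less[of n \<pi> \<rho>] bruhat_less_imp_perm_length_less[of n \<rho> ?\<sigma>]
    by auto
  then show ?thesis
    using bruhat_step_imp_bruhat_less[OF \<pi> step] by (simp add: bruhat_covered_by_def)
qed

text \<open>
  If a point at \<open>m\<close> lies in the rectangle, the exchange of positions \<open>i\<close> and \<open>j\<close> factors into three
  length-increasing exchanges: with values \<open>x < y < z\<close> at \<open>i < m < j\<close>, the pattern \<open>xyz\<close> becomes
  \<open>yxz\<close>, then \<open>zxy\<close>, then \<open>zyx\<close>.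
\<close>

lemma not_bruhat_covered_by_if_blocked:
  assumes \<pi>: "\<pi> permutes {1..n}" and ij: "1 \<le> i" "i < m" "m < j" "j \<le> n"
    and less: "\<pi> i < \<pi> m" "\<pi> m < \<pi> j"
  shows "\<not> bruhat_covered_by n \<pi> (\<pi> \<circ> Transposition.transpose i j)"
proof -
  let ?\<rho> = "\<pi> \<circ> Transposition.transpose i m"
  let ?\<rho>' = "?\<rho> \<circ> Transposition.transpose i j"
  let ?\<sigma> = "\<pi> \<circ> Transposition.transpose i j"
  have \<sigma>: "?\<sigma> = ?\<rho>' \<circ> Transposition.transpose m j"
    using ij by (auto simp: fun_eq_iff Transposition.transpose_def)
  have \<rho>: "?\<rho> permutes {1..n}" "?\<rho>' permutes {1..n}" "?\<sigma> permutes {1..n}"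
    by (intro permutes_comp_transpose \<pi>; use ij in simp)+
  have 1: "bruhat_step n \<pi> ?\<rho>"
    unfolding bruhat_step_iff[OF \<pi>] using ij less by (intro exI[of _ i] exI[of _ m]) auto
  have 2: "bruhat_step n ?\<rho> ?\<rho>'"
    unfolding bruhat_step_iff[OF \<rho>(1)] using ij less by (intro exI[of _ i] exI[of _ j]) auto
  have 3: "bruhat_step n ?\<rho>' ?\<sigma>"
    unfolding bruhat_step_iff[OF \<rho>(2)] using ij less \<sigma>
    by (intro exI[of _ m] exI[of _ j]) (auto simp: Transposition.transpose_def)
  have "perm_length n ?\<rho> < perm_length n ?\<sigma>"
    using 2 3 by (auto simp: bruhat_step_def)
  then have "bruhat_less n ?\<rho> ?\<sigma>"
    using 2 3 \<rho> unfolding bruhat_less_def bruhat_le_def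
    by (metis converse_rtranclp_into_rtranclp less_irrefl rtranclp.rtrancl_refl)
  then show ?thesis
    using bruhat_step_imp_bruhat_less[OF \<pi> 1] by (auto simp: bruhat_covered_by_def)
qed

lemma bruhat_covered_by_iff:
  "bruhat_covered_by n \<pi> \<sigma> \<longleftrightarrow> \<pi> permutes {1..n} \<and>
     (\<exists>i j. (i, j) \<in> visible_pairs {1..n} \<pi> \<and> \<pi> i < \<pi> j \<and> \<sigma> = \<pi> \<circ> Transposition.transpose i j)"
  (is "_ \<longleftrightarrow> ?rhs")
proof
  assume cov: "bruhat_covered_by n \<pi> \<sigma>"
  then have \<pi>: "\<pi> permutes {1..n}" and \<sigma>: "\<sigma> permutes {1..n}"
    and chain: "(bruhat_step n)\<^sup>*\<^sup>* \<pi> \<sigma>" "\<pi> \<noteq> \<sigma>"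
    by (auto simp: bruhat_covered_by_def bruhat_less_def bruhat_le_def)
  then obtain \<rho> where \<rho>: "bruhat_step n \<pi> \<rho>" "(bruhat_step n)\<^sup>*\<^sup>* \<rho> \<sigma>"
    by (metis converse_rtranclpE)
  have "\<rho> = \<sigma>"
  proof (rule ccontr)
    assume "\<rho> \<noteq> \<sigma>"
    then have "bruhat_less n \<rho> \<sigma>"
      using \<rho> \<sigma> bruhat_step_permutes[OF \<pi>] by (simp add: bruhat_less_def bruhat_le_def)
    then show False
      using cov bruhat_step_imp_bruhat_less[OF \<pi> \<rho>(1)] by (auto simp: bruhat_covered_by_def)
  qed
  then obtain i j where ij: "1 \<le> i" "i < j" "j \<le> n" "\<pi> i < \<pi> j"
    and eq: "\<sigma> = \<pi> \<circ> Transposition.transpose i j"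
    using \<rho>(1) bruhat_step_iff[OF \<pi>] by blast
  have "\<not> (\<pi> i < \<pi> m \<and> \<pi> m < \<pi> j)" if "i < m" "m < j" for m
    using cov not_bruhat_covered_by_if_blocked[OF \<pi> ij(1) that ij(3)] eq by blast
  then have "(i, j) \<in> visible_pairs {1..n} \<pi>"
    using ij by (auto simp: visible_pairs_def)
  then show ?rhs
    using \<pi> ij eq by blast
next
  assume ?rhs
  then show "bruhat_covered_by n \<pi> \<sigma>"
    using visible_imp_bruhat_covered_by by blast
qed

lemma inj_on_comp_transpose:
  assumes "inj \<pi>"
  shows "inj_on (\<lambda>(i, j). \<pi> \<circ> Transposition.transpose i j) {(i, j). i < (j::'a::linorder)}"
proof (rule inj_onI, clarify)
  fix i j k l :: 'a
  assume less: "i < j" "k < l" and "\<pi> \<circ> Transposition.transpose i j = \<pi> \<circ> Transposition.transpose k l"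
  then have "Transposition.transpose i j x = Transposition.transpose k l x" for x
    using assms by (metis comp_apply injD)
  from this[of i] this[of j] show "i = k \<and> j = l"
    using less by (auto simp: Transposition.transpose_def split: if_splits)
qed

text \<open>
  Visible pairs that are in order give the permutations covering \<open>\<pi>\<close>, those that are inverted the
  permutations covered by \<open>\<pi>\<close>.
\<close>

lemma total_degree_eq_card_visible_pairs:
  assumes \<pi>: "\<pi> permutes {1..n}"
  shows "total_degree n \<pi> = card (visible_pairs {1..n} \<pi>)"
proof -
  let ?V = "visible_pairs {1..n} \<pi>"
  let ?swap = "\<lambda>(i, j). \<pi> \<circ> Transposition.transpose i j"
  define U where "U = {(i, j) \<in> ?V. \<pi> i < \<pi> j}"
  define D where "D = {(i, j) \<in> ?V. \<pi> j < \<pi> i}"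
  have V_less: "i < j" if "(i, j) \<in> ?V" for i j
    using that by (simp add: visible_pairs_def)
  have fin: "finite ?V"
    by (rule finite_subset[of _ "{1..n} \<times> {1..n}"]) (auto simp: visible_pairs_def)
  have "{\<sigma>. bruhat_covered_by n \<pi> \<sigma>} = ?swap ` U"
    using \<pi> by (auto simp: bruhat_covered_by_iff U_def)
  moreover have "{\<sigma>. bruhat_covered_by n \<sigma> \<pi>} = ?swap ` D"
  proof (intro equalityI subsetI)
    fix \<sigma> assume "\<sigma> \<in> {\<sigma>. bruhat_covered_by n \<sigma> \<pi>}"
    then obtain i j where \<sigma>: "(i, j) \<in> visible_pairs {1..n} \<sigma>" "\<sigma> i < \<sigma> j"
      "\<pi> = \<sigma> \<circ> Transposition.transpose i j"
      by (auto simp: bruhat_covered_by_iff)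
    then have "(i, j) \<in> D"
      by (auto simp: D_def visible_pairs_def)
    moreover have "\<sigma> = ?swap (i, j)"
      by (simp add: \<sigma>(3) comp_assoc)
    ultimately show "\<sigma> \<in> ?swap ` D" by blast
  next
    fix \<sigma> assume "\<sigma> \<in> ?swap ` D"
    then obtain i j where ij: "(i, j) \<in> ?V" "\<pi> j < \<pi> i" and \<sigma>: "\<sigma> = \<pi> \<circ> Transposition.transpose i j"
      by (auto simp: D_def)
    have "\<sigma> permutes {1..n}"
      unfolding \<sigma> using \<pi> ij by (intro permutes_comp_transpose) (auto simp: visible_pairs_def)
    moreover have "(i, j) \<in> visible_pairs {1..n} \<sigma>" "\<sigma> i < \<sigma> j"
      using ij \<sigma> by (auto simp: visible_pairs_def)
    moreover have "\<pi> = \<sigma> \<circ> Transposition.transpose i j"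
      by (simp add: \<sigma> comp_assoc)
    ultimately show "\<sigma> \<in> {\<sigma>. bruhat_covered_by n \<sigma> \<pi>}"
      by (auto simp: bruhat_covered_by_iff)
  qed
  moreover have "inj_on ?swap U" "inj_on ?swap D"
    by (rule inj_on_subset[OF inj_on_comp_transpose[OF permutes_inj[OF \<pi>]]];
        use V_less in \<open>auto simp: U_def D_def\<close>)+
  ultimately have "total_degree n \<pi> = card D + card U"
    by (simp add: total_degree_def card_image)
  also have "\<dots> = card (D \<union> U)"
    using fin by (intro card_Un_disjoint[symmetric]) (auto simp: U_def D_def elim!: rev_finite_subset)
  also have "D \<union> U = ?V"
  proof -
    have "\<pi> i < \<pi> j \<or> \<pi> j < \<pi> i" if "(i, j) \<in> ?V" for i j
      using V_less[OF that] inj_onD[OF permutes_inj[OF \<pi>], of i j] by fastforce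
    then show ?thesis by (auto simp: U_def D_def)
  qed
  finally show ?thesis .
qed


section \<open>The maximal number of visible pairs\<close>

text \<open>
  Two common neighbours of \<open>p\<close> and \<open>q\<close> that lie between them and on the same side are impossible: seen
  from \<open>p\<close>, the nearer position must have the more extreme value, seen from \<open>q\<close> it is the other one.
\<close>

lemma common_neighbours_between_le_2:
  fixes \<pi> :: "'a::linorder \<Rightarrow> 'b::linorder"
  assumes inj: "inj_on \<pi> S" and pq: "(p, q) \<in> visible_pairs S \<pi>"
  shows "card {r. (p, r) \<in> visible_pairs S \<pi> \<and> (r, q) \<in> visible_pairs S \<pi>} \<le> 2"
proof -
  define A where "A = {r. (p, r) \<in> visible_pairs S \<pi> \<and> (r, q) \<in> visible_pairs S \<pi> \<and> \<pi> p < \<pi> r \<and> \<pi> q < \<pi> r}"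
  define B where "B = {r. (p, r) \<in> visible_pairs S \<pi> \<and> (r, q) \<in> visible_pairs S \<pi> \<and> \<pi> r < \<pi> p \<and> \<pi> r < \<pi> q}"
  have "\<not> r < r'" if "r \<in> A" "r' \<in> A" for r r'
  proof
    assume "r < r'"
    moreover from this that have "\<not> \<pi> r < \<pi> r'" "\<not> \<pi> r' < \<pi> r"
      by (auto simp: A_def visible_pairs_def)
    ultimately show False
      using that inj by (auto simp: A_def visible_pairs_def dest: inj_onD)
  qed
  then have A: "\<forall>r\<in>A. \<forall>r'\<in>A. r = r'"
    by (meson linorder_neqE)
  have "\<not> r < r'" if "r \<in> B" "r' \<in> B" for r r'
  proof
    assume "r < r'"
    moreover from this that have "\<not> \<pi> r < \<pi> r'" "\<not> \<pi> r' < \<pi> r"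
      by (auto simp: B_def visible_pairs_def)
    ultimately show False
      using that inj by (auto simp: B_def visible_pairs_def dest: inj_onD)
  qed
  then have B: "\<forall>r\<in>B. \<forall>r'\<in>B. r = r'"
    by (meson linorder_neqE)
  have fin: "finite A" "finite B"
    using A B by (metis finite.simps finite_insert subsetI finite_subset insertCI all_not_in_conv)+
  have "{r. (p, r) \<in> visible_pairs S \<pi> \<and> (r, q) \<in> visible_pairs S \<pi>} \<subseteq> A \<union> B"
  proof clarify
    fix r assume r: "(p, r) \<in> visible_pairs S \<pi>" "(r, q) \<in> visible_pairs S \<pi>" "r \<notin> B"
    then have "\<pi> r \<noteq> \<pi> p" "\<pi> r \<noteq> \<pi> q"
      using inj by (auto simp: visible_pairs_def dest: inj_onD)
    moreover have "\<not> (\<pi> p < \<pi> r \<and> \<pi> r < \<pi> q)" "\<not> (\<pi> q < \<pi> r \<and> \<pi> r < \<pi> p)"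
      using pq r by (auto simp: visible_pairs_def)
    ultimately show "r \<in> A"
      using r unfolding A_def B_def by (metis (mono_tags, lifting) linorder_neqE mem_Collect_eq)
  qed
  then have "card {r. (p, r) \<in> visible_pairs S \<pi> \<and> (r, q) \<in> visible_pairs S \<pi>} \<le> card (A \<union> B)"
    using fin by (intro card_mono) auto
  also have "\<dots> \<le> card A + card B"
    by (rule card_Un_le)
  also have "\<dots> \<le> 1 + 1"
    using A B fin by (intro add_mono) (auto simp: card_le_Suc0_iff_eq)
  finally show ?thesis by simp
qed

lemma finite_visible_pairs: "finite S \<Longrightarrow> finite (visible_pairs S \<pi>)"
  by (rule finite_subset[of _ "S \<times> S"]) (auto simp: visible_pairs_def)

text \<open>
  The bound is \<open>(card S)\<^sup>2 div 4 + card S - 2\<close>; adding 2 on the left avoids a truncated subtraction.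
  The induction reaches the cases \<open>card S = 2\<close> and \<open>card S = 3\<close> by deleting all points but at most
  one, so that no visible pairs remain.
\<close>

lemma card_visible_pairs_le:
  fixes S :: "nat set" and \<pi> :: "nat \<Rightarrow> 'b::linorder"
  assumes "finite S" "inj_on \<pi> S" "2 \<le> card S"
  shows "card (visible_pairs S \<pi>) + 2 \<le> (card S)\<^sup>2 div 4 + card S"
  using assms
proof (induction "card S" arbitrary: S rule: less_induct)
  case less
  let ?V = "visible_pairs S \<pi>"
  have finV: "finite ?V"
    using less.prems by (simp add: finite_visible_pairs)
  show ?case
  proof (cases "?V = {}")
    case True
    then show ?thesis using less.prems by simp
  next
    case False
    then have "Max ((\<lambda>(i, j). j - i) ` ?V) \<in> (\<lambda>(i, j). j - i) ` ?V"
      using finV by (intro Max_in) auto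
    then obtain p q where pq: "(p, q) \<in> ?V" and "q - p = Max ((\<lambda>(i, j). j - i) ` ?V)"
      by auto
    then have widest: "j - i \<le> q - p" if "(i, j) \<in> ?V" for i j
      using finV that by (auto intro!: Max_ge simp: image_iff)
    have mem: "p \<in> S" "q \<in> S" "p < q"
      using pq by (auto simp: visible_pairs_def)
    define T where "T = S - {p, q}"
    define nbr where "nbr s = {r \<in> T. (min s r, max s r) \<in> ?V}" for s
    have T: "finite T" "inj_on \<pi> T" "card S = card T + 2"
      using less.prems mem card_Diff_subset[of "{p, q}" S]
      by (auto simp: T_def intro: inj_on_subset)
    have nbr: "nbr s \<subseteq> T" "finite (nbr s)" for s
      using T by (auto simp: nbr_def)
    \<comment> \<open>A common neighbour left of \<open>p\<close> would see \<open>q\<close> over a larger distance, one right of \<open>q\<close> would see \<open>p\<close>.\<close>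
    have "nbr p \<inter> nbr q \<subseteq> {r. (p, r) \<in> ?V \<and> (r, q) \<in> ?V}"
    proof
      fix r assume r: "r \<in> nbr p \<inter> nbr q"
      have "\<not> r < p" "\<not> q < r"
        using r mem widest[of r q] widest[of p r] by (auto simp: nbr_def min_def max_def split: if_splits)
      then show "r \<in> {r. (p, r) \<in> ?V \<and> (r, q) \<in> ?V}"
        using r by (auto simp: nbr_def T_def min_def max_def split: if_splits)
    qed
    moreover have "finite {r. (p, r) \<in> ?V \<and> (r, q) \<in> ?V}"
      using less.prems by (auto simp: visible_pairs_def)
    ultimately have common: "card (nbr p \<inter> nbr q) \<le> 2"
      using common_neighbours_between_le_2[OF less.prems(2) pq] card_mono order_trans by blast
    have common': "card (nbr p \<inter> nbr q) \<le> card T"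
      using T nbr by (intro card_mono) auto
    \<comment> \<open>Deleting \<open>p\<close> and \<open>q\<close> keeps every visible pair that does not involve them.\<close>
    have "?V \<subseteq> visible_pairs T \<pi> \<union> {(p, q)} \<union> (\<lambda>r. (min p r, max p r)) ` nbr p
                \<union> (\<lambda>r. (min q r, max q r)) ` nbr q"
      (is "_ \<subseteq> ?R")
    proof (rule subrelI, rule ccontr)
      fix i j assume "(i, j) \<in> ?V" "(i, j) \<notin> ?R"
      then have ij: "(i, j) \<in> ?V" "(i, j) \<notin> (\<lambda>r. (min q r, max q r)) ` nbr q"
        "(i, j) \<notin> (\<lambda>r. (min p r, max p r)) ` nbr p" "(i, j) \<noteq> (p, q)" "(i, j) \<notin> visible_pairs T \<pi>"
        by blast+
      have less_ij: "i < j" "i \<in> S" "j \<in> S"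
        using ij(1) by (auto simp: visible_pairs_def)
      have no: "(i, j) \<noteq> (min s r, max s r)" if "s = p \<or> s = q" "r \<in> T" for s r
        using ij that unfolding nbr_def by blast
      have "i \<in> T"
        using no[of i j] ij(4) less_ij mem by (auto simp: T_def)
      moreover have "j \<in> T"
        using no[of j i] ij(4) less_ij mem by (auto simp: T_def)
      ultimately show False
        using ij(1,5) by (auto simp: visible_pairs_def T_def)
    qed
    then have "card ?V \<le> card (visible_pairs T \<pi> \<union> {(p, q)} \<union> (\<lambda>r. (min p r, max p r)) ` nbr p
                \<union> (\<lambda>r. (min q r, max q r)) ` nbr q)"
      using T nbr by (intro card_mono) (simp_all add: finite_visible_pairs)
    also have "\<dots> \<le> card (visible_pairs T \<pi>) + 1 + card (nbr p) + card (nbr q)"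
      by (intro order_trans[OF card_Un_le] add_mono card_image_le nbr) auto
    also have "\<dots> = card (visible_pairs T \<pi>) + 1 + card (nbr p \<union> nbr q) + card (nbr p \<inter> nbr q)"
      using card_Un_Int[OF nbr(2) nbr(2), of p q] by simp
    also have "\<dots> \<le> card (visible_pairs T \<pi>) + 1 + card T + card (nbr p \<inter> nbr q)"
      using card_mono[of T "nbr p \<union> nbr q"] T(1) nbr(1) by simp
    finally have count: "card ?V \<le> card (visible_pairs T \<pi>) + 1 + card T + card (nbr p \<inter> nbr q)" .
    \<comment> \<open>The bound grows by \<open>card T + 3\<close> from \<open>T\<close> to \<open>S\<close>, which covers up to two common neighbours.\<close>
    have "(card S)\<^sup>2 = (card T)\<^sup>2 + (card T + 1) * 4"
      using T by (simp add: power2_eq_square algebra_simps)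
    then have sq: "(card S)\<^sup>2 div 4 = (card T)\<^sup>2 div 4 + card T + 1"
      by simp
    show ?thesis
    proof (cases "2 \<le> card T")
      case True
      then have "card (visible_pairs T \<pi>) + 2 \<le> (card T)\<^sup>2 div 4 + card T"
        using less.hyps[of T] T by simp
      then show ?thesis
        using count common sq T(3) by linarith
    next
      case False
      then have "\<forall>i\<in>T. \<forall>j\<in>T. i = j"
        using T by (auto simp: card_le_Suc0_iff_eq[symmetric])
      then have "visible_pairs T \<pi> = {}"
        by (auto simp: visible_pairs_def)
      then have "card ?V \<le> 1 + card T + card T"
        using count common' by simp
      then show ?thesis
        using False sq T(3) by linarith
    qed
  qed
qed

text \<open>In one-line notation this is \<open>[h+1, \<dots>, n, 1, \<dots>, h]\<close> with \<open>h = n div 2\<close>.\<close>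

definition two_blocks :: "nat \<Rightarrow> nat \<Rightarrow> nat" where
  "two_blocks n i =
     (if i \<in> {1..n} then if i \<le> n - n div 2 then i + n div 2 else i - (n - n div 2) else i)"

lemma two_blocks_permutes: "two_blocks n permutes {1..n}"
proof (rule inj_imp_permutes)
  show "inj_on (two_blocks n) {1..n}"
    by (auto simp: two_blocks_def inj_on_def split: if_splits)
qed (auto simp: two_blocks_def)

lemma le_card_visible_pairs_two_blocks:
  assumes "2 \<le> n"
  shows "n\<^sup>2 div 4 + n - 2 \<le> card (visible_pairs {1..n} (two_blocks n))"
proof -
  define h where "h = n div 2"
  define c where "c = n - h"
  let ?across = "{1..c} \<times> {c<..n}"
  \<comment> \<open>The consecutive pair \<open>(c, c + 1)\<close> is left out, as it already belongs to \<open>?across\<close>.\<close>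
  let ?along = "(\<lambda>i. (i, i + 1)) ` ({1..<n} - {c})"
  have n: "n = c + h" "1 \<le> c" "1 \<le> h"
    using assms by (auto simp: c_def h_def)
  have "n\<^sup>2 div 4 = c * h"
  proof (cases "even n")
    case True
    then obtain m where "n = 2 * m" by blast
    then show ?thesis by (simp add: c_def h_def power2_eq_square)
  next
    case False
    then obtain m where m: "n = 2 * m + 1" by (blast elim: oddE)
    then have "n\<^sup>2 = (m * (m + 1)) * 4 + 1"
      by (simp add: power2_eq_square algebra_simps)
    moreover have "c * h = m * (m + 1)"
      using m by (simp add: c_def h_def)
    ultimately show ?thesis by simp
  qed
  moreover have "card ?across = c * h"
    using n by simp
  moreover have "card ?along = n - 2"
    using n by (subst card_image) (auto simp: inj_on_def)
  moreover have "card (?across \<union> ?along) = card ?across + card ?along"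
    by (intro card_Un_disjoint) auto
  moreover have "card (?across \<union> ?along) \<le> card (visible_pairs {1..n} (two_blocks n))"
  proof (rule card_mono)
    show "?across \<union> ?along \<subseteq> visible_pairs {1..n} (two_blocks n)"
    proof (rule subrelI)
      have vals: "two_blocks n k = (if k \<le> c then k + h else k - c)" if "k \<in> {1..n}" for k
        using that unfolding two_blocks_def c_def h_def by simp
      fix i j assume "(i, j) \<in> ?across \<union> ?along"
      then consider "1 \<le> i" "i \<le> c" "c < j" "j \<le> n" | "1 \<le> i" "i < n" "j = i + 1"
        by auto
      then show "(i, j) \<in> visible_pairs {1..n} (two_blocks n)"
      proof cases
        case 1
        then show ?thesis
          using n(1) by (auto simp: visible_pairs_def vals[unfolded n(1)] simp del: One_nat_def)
      next
        case 2
        then show ?thesis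
          by (auto simp: visible_pairs_def)
      qed
    qed
  qed (simp add: finite_visible_pairs)
  ultimately show ?thesis
    using assms by linarith
qed

theorem theorem3p1:
  fixes n :: nat
  assumes "n \<ge> 2"
  shows "Max {total_degree n \<pi> | \<pi>. \<pi> permutes {1..n}} = n\<^sup>2 div 4 + n - 2"
proof (rule Max_eqI)
  have "{total_degree n \<pi> | \<pi>. \<pi> permutes {1..n}} = total_degree n ` {\<pi>. \<pi> permutes {1..n}}"
    by blast
  then show "finite {total_degree n \<pi> | \<pi>. \<pi> permutes {1..n}}"
    by (simp add: finite_permutations)
  have upper: "total_degree n \<pi> \<le> n\<^sup>2 div 4 + n - 2" if "\<pi> permutes {1..n}" for \<pi>
    using card_visible_pairs_le[of "{1..n}" \<pi>] permutes_inj_on[OF that] assms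
    by (simp add: total_degree_eq_card_visible_pairs[OF that])
  then show "d \<le> n\<^sup>2 div 4 + n - 2" if "d \<in> {total_degree n \<pi> | \<pi>. \<pi> permutes {1..n}}" for d
    using that by blast
  have "total_degree n (two_blocks n) = n\<^sup>2 div 4 + n - 2"
    using upper[OF two_blocks_permutes] le_card_visible_pairs_two_blocks[OF assms]
    by (simp add: total_degree_eq_card_visible_pairs[OF two_blocks_permutes])
  then show "n\<^sup>2 div 4 + n - 2 \<in> {total_degree n \<pi> | \<pi>. \<pi> permutes {1..n}}"
    using two_blocks_permutes by (metis (mono_tags, lifting) mem_Collect_eq)
qed

end
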